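(* Let $A$ be a closed symmetric operator in a complex Hilbert space $\mathcal{H}$ such that $\ker(A)=\{0\}$, and let $C$ be a complex conjugation on $\mathcal{H}$ such that $CA\subseteq AC$. Suppose that $d_+(A)=1$ and $\dim\ker(A^* )=1$. Let $\varphi\in\ker(A^* )\setminus\{0\}$ be such that $C\varphi=\varphi$. Then for every $(t_1,t_2)\in\mathbb{R}\times\mathbb{R}$ such that $t_1\ne t_2$, there exist $(\psi_1,\psi_2)\in\mathscr{S}_{A,C}^{\varphi}\times\mathscr{S}_{A,C}^{\varphi}$ such that $$\mathcal{D}_{t_1,\psi_1}^{\varphi}=\mathcal{D}_{t_2,\psi_2}^{\varphi}.$$
   Context: Inner products are linear in the second variable and anti-linear in the first. Operators are linear and possibly unbounded; $\mathcal{D}(A)$ is the domain of $A$. $A$ is symmetric if it is densely defined and $A\subseteq A^*$. The deficiency index $d_+(A)$ of a symmetric operator $A$ is $\dim\ker(A^*-iI)$. A complex conjugation $C$ on $\mathcal{H}$ is an anti-linear map $C\colon\mathcal{H}\to\mathcal{H}$ with $C(Cf)=f$ and $\langle Cf,Cg\rangle=\langle g,f\rangle$ for all $f,g\in\mathcal{H}$. $CA\subseteq AC$ means $C(\mathcal{D}(A))\subseteq\mathcal{D}(A)$ and $CAf=ACf$ for all $f\in\mathcal{D}(A)$. For $\varphi\in\ker(A^* )$: $\mathscr{S}_{A,C}^{\varphi}=\{\psi\in\mathcal{D}(A^* )\setminus\mathcal{D}(A)\colon C\psi=\psi,\ \langle\psi,A^*\psi\rangle=0,\ \langle\varphi,A^*\psi\rangle=1\}$.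 For $t\in\mathbb{R}$ and $\psi\in\mathscr{S}_{A,C}^{\varphi}$: $\mathcal{D}_{t,\psi}^{\varphi}=\mathcal{D}(A)+\{\alpha(t\varphi+\psi)\colon\alpha\in\mathbb{C}\}$. *)

theory Defs
  imports "HOL-Analysis.Analysis"
begin

section \<open>Complex Hilbert spaces\<close>

text \<open>The norm axiom yields positive definiteness of the inner product, and
  the superclass \<^class>\<open>banach\<close> provides completeness.\<close>

class complex_hilbert_space = banach +
  fixes scaleC :: "complex \<Rightarrow> 'a \<Rightarrow> 'a" (infixr \<open>*\<^sub>C\<close> 75)
    and cinner :: "'a \<Rightarrow> 'a \<Rightarrow> complex"
  assumes scaleC_add_right: "a *\<^sub>C (x + y) = a *\<^sub>C x + a *\<^sub>C y"
    and scaleC_add_left: "(a + b) *\<^sub>C x = a *\<^sub>C x + b *\<^sub>C x"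
    and scaleC_scaleC: "a *\<^sub>C b *\<^sub>C x = (a * b) *\<^sub>C x"
    and scaleR_scaleC: "r *\<^sub>R x = complex_of_real r *\<^sub>C x"
    and cinner_add_right: "cinner x (y + z) = cinner x y + cinner x z"
    and cinner_scaleC_right: "cinner x (a *\<^sub>C y) = a * cinner x y"
    and cinner_commute: "cinner x y = cnj (cinner y x)"
    and cinner_self: "cinner x x = complex_of_real ((norm x)\<^sup>2)"

lemma scaleC_one: "1 *\<^sub>C x = (x :: 'a :: complex_hilbert_space)"
  using scaleR_scaleC[of 1 x] by simp

interpretation complex_vector:
  vector_space "scaleC :: complex \<Rightarrow> 'h \<Rightarrow> 'h :: complex_hilbert_space"
  by standard (rule scaleC_add_right scaleC_add_left scaleC_scaleC scaleC_one)+

lemma cinner_diff_right: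
  "cinner x (y - z) = cinner x y - cinner (x :: 'h :: complex_hilbert_space) z"
  using cinner_add_right[of x "y - z" z] by simp

lemma cinner_diff_left:
  "cinner (x - y) z = cinner x z - cinner (y :: 'h :: complex_hilbert_space) z"
  by (metis cinner_commute cinner_diff_right complex_cnj_diff)

section \<open>Unbounded operators\<close>

text \<open>An operator is a partial map; its domain is \<^term>\<open>dom A\<close>, its graph is
  \<^term>\<open>Map.graph A\<close>, and extension of operators is \<open>\<subseteq>\<^sub>m\<close>.\<close>

type_synonym 'h operator = "'h \<rightharpoonup> 'h"

definition app :: "'h operator \<Rightarrow> 'h \<Rightarrow> 'h"  (infixr \<open>\<cdot>\<close> 80) where
  "A \<cdot> f = the (A f)"

definition linear_operator :: "'h::complex_hilbert_space operator \<Rightarrow> bool" where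
  "linear_operator A \<longleftrightarrow>
     complex_vector.subspace (dom A) \<and>
     (\<forall>f\<in>dom A. \<forall>g\<in>dom A. A \<cdot> (f + g) = A \<cdot> f + A \<cdot> g) \<and>
     (\<forall>a. \<forall>f\<in>dom A. A \<cdot> (a *\<^sub>C f) = a *\<^sub>C A \<cdot> f)"

definition densely_defined :: "'h::complex_hilbert_space operator \<Rightarrow> bool" where
  "densely_defined A \<longleftrightarrow> closure (dom A) = UNIV"

definition closed_operator :: "'h::complex_hilbert_space operator \<Rightarrow> bool" where
  "closed_operator A \<longleftrightarrow> closed (Map.graph A)"

definition ker :: "'h::complex_hilbert_space operator \<Rightarrow> 'h set" where
  "ker A = {f \<in> dom A. A \<cdot> f = 0}"

text \<open>The value \<open>h\<close> is unique when \<open>A\<close> is densely defined; the adjoint is only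
  meaningful for such \<open>A\<close>.\<close>

definition adjoint :: "'h::complex_hilbert_space operator \<Rightarrow> 'h operator"
  (\<open>_\<^sup>\<dagger>\<close> [1000] 999) where
  "A\<^sup>\<dagger> = (\<lambda>g. if \<exists>h. \<forall>f\<in>dom A. cinner g (A \<cdot> f) = cinner h f
               then Some (THE h. \<forall>f\<in>dom A. cinner g (A \<cdot> f) = cinner h f)
               else None)"

definition symmetric_operator :: "'h::complex_hilbert_space operator \<Rightarrow> bool" where
  "symmetric_operator A \<longleftrightarrow> linear_operator A \<and> densely_defined A \<and> A \<subseteq>\<^sub>m A\<^sup>\<dagger>"

text \<open>The operator \<open>A - z I\<close>.\<close>

definition minus_scalar :: "'h::complex_hilbert_space operator \<Rightarrow> complex \<Rightarrow> 'h operator" where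
  "minus_scalar A z = (\<lambda>f. map_option (\<lambda>h. h - z *\<^sub>C f) (A f))"

text \<open>\<^const>\<open>complex_vector.dim\<close> is 0 on infinite-dimensional spaces, so this is
  the deficiency index only when the latter is finite.\<close>

definition deficiency_plus :: "'h::complex_hilbert_space operator \<Rightarrow> nat" where
  "deficiency_plus A = complex_vector.dim (ker (minus_scalar (A\<^sup>\<dagger>) \<i>))"

lemma orthogonal_dense_eq_0:
  fixes u :: "'h :: complex_hilbert_space"
  assumes "closure D = UNIV" and orth: "\<And>f. f \<in> D \<Longrightarrow> cinner u f = 0"
  shows "u = 0"
proof (rule ccontr)
  assume "u \<noteq> 0"
  moreover have "u \<in> closure D" using assms(1) by simp
  ultimately obtain f where f: "f \<in> D" "dist f u < norm u"
    by (metis closure_approachable zero_less_norm_iff)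
  have "cinner f u = 0" using orth[OF f(1)] cinner_commute[of f u] by simp
  then have "cinner (f - u) (f - u) = cinner f f + cinner u u"
    by (simp add: cinner_diff_left cinner_diff_right orth[OF f(1)])
  then have "complex_of_real ((norm (f - u))\<^sup>2) = complex_of_real ((norm f)\<^sup>2 + (norm u)\<^sup>2)"
    by (simp add: cinner_self)
  then have "(norm (f - u))\<^sup>2 = (norm f)\<^sup>2 + (norm u)\<^sup>2"
    by (simp only: of_real_eq_iff)
  moreover have "(norm (f - u))\<^sup>2 < (norm u)\<^sup>2"
    using f(2) by (intro power_strict_mono) (auto simp: dist_norm)
  ultimately show False using zero_le_power2[of "norm f"] by linarith
qed

lemma adjoint_eq_Some_iff:
  assumes "densely_defined A"
  shows "(A\<^sup>\<dagger>) g = Some h \<longleftrightarrow> (\<forall>f\<in>dom A. cinner g (A \<cdot> f) = cinner h f)"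
proof -
  have uniq: "h = h'" if "\<forall>f\<in>dom A. cinner g (A \<cdot> f) = cinner h f"
      "\<forall>f\<in>dom A. cinner g (A \<cdot> f) = cinner h' f" for h h'
  proof -
    have "h - h' = 0"
      by (rule orthogonal_dense_eq_0[of "dom A"])
        (use assms that in \<open>auto simp: densely_defined_def cinner_diff_left\<close>)
    then show ?thesis by simp
  qed
  show ?thesis
  proof (cases "\<exists>h. \<forall>f\<in>dom A. cinner g (A \<cdot> f) = cinner h f")
    case True
    then obtain k where k: "\<forall>f\<in>dom A. cinner g (A \<cdot> f) = cinner k f" by blast
    then have "(THE h. \<forall>f\<in>dom A. cinner g (A \<cdot> f) = cinner h f) = k"
      using uniq by (intro the_equality) auto
    then have "(A\<^sup>\<dagger>) g = Some k" using True by (simp add: adjoint_def)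
    then show ?thesis using uniq k by auto
  qed (auto simp: adjoint_def)
qed

section \<open>Conjugations and one-dimensional extensions of the domain\<close>

definition complex_conjugation :: "('h::complex_hilbert_space \<Rightarrow> 'h) \<Rightarrow> bool" where
  "complex_conjugation C \<longleftrightarrow>
     (\<forall>f g. C (f + g) = C f + C g) \<and>
     (\<forall>a f. C (a *\<^sub>C f) = cnj a *\<^sub>C C f) \<and>
     (\<forall>f. C (C f) = f) \<and>
     (\<forall>f g. cinner (C f) (C g) = cinner g f)"

text \<open>The inclusion \<open>C A \<subseteq> A C\<close>.\<close>

definition commutes_with :: "('h::complex_hilbert_space \<Rightarrow> 'h) \<Rightarrow> 'h operator \<Rightarrow> bool" where
  "commutes_with C A \<longleftrightarrow> C ` dom A \<subseteq> dom A \<and> (\<forall>f\<in>dom A. C (A \<cdot> f) = A \<cdot> C f)"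

definition S_set ::
  "'h::complex_hilbert_space operator \<Rightarrow> ('h \<Rightarrow> 'h) \<Rightarrow> 'h \<Rightarrow> 'h set" where
  "S_set A C \<phi> = {\<psi> \<in> dom (A\<^sup>\<dagger>) - dom A.
     C \<psi> = \<psi> \<and> cinner \<psi> (A\<^sup>\<dagger> \<cdot> \<psi>) = 0 \<and> cinner \<phi> (A\<^sup>\<dagger> \<cdot> \<psi>) = 1}"

definition ext_dom ::
  "'h::complex_hilbert_space operator \<Rightarrow> 'h \<Rightarrow> real \<Rightarrow> 'h \<Rightarrow> 'h set" where
  "ext_dom A \<phi> t \<psi> =
     {f + \<alpha> *\<^sub>C (complex_of_real t *\<^sub>C \<phi> + \<psi>) | f \<alpha>. f \<in> dom A}"

end

theory Submission
  imports Defs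
begin

text \<open>Since \<open>A\<close> is closed with trivial kernel, \<open>(\<phi>, 0)\<close> lies outside the closed graph of \<open>A\<close>.
  Its orthogonal component with respect to the graph is a pair \<open>(u, v)\<close> with \<open>A\<^sup>\<dagger> v = - u\<close> and
  \<open>\<langle>\<phi>, u\<rangle> \<noteq> 0\<close>. Scaling and symmetrising \<open>v\<close> under \<open>C\<close> gives a real \<open>\<psi>\<close> in the domain
  of \<open>A\<^sup>\<dagger>\<close> with \<open>\<langle>\<phi>, A\<^sup>\<dagger> \<psi>\<rangle> = 1\<close>. For a real \<open>f\<close> in the domain of \<open>A\<close> the quadratic
  polynomial \<open>q x = \<langle>\<psi> + x f, A\<^sup>\<dagger> (\<psi> + x f)\<rangle>\<close> is real, and \<open>\<psi> + x f - q x \<phi>\<close> satisfies all the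
  conditions on \<open>\<psi>\<close>. By density, \<open>f\<close> can be chosen so that the linear coefficient of \<open>q\<close> does not
  vanish; then the differences \<open>q x - q y\<close> attain every real value, in particular \<open>t\<^sub>1 - t\<^sub>2\<close>.\<close>

section \<open>Orthogonal projection in the product of two Hilbert spaces\<close>

text \<open>A minimising sequence is Cauchy by the parallelogram law. That law is a hypothesis on a
  Banach space so that the result applies to the product \<open>'h \<times> 'h\<close> with its
  product norm.\<close>

lemma closest_point_parallelogram:
  fixes S :: "'a::banach set"
  assumes par: "\<And>x y :: 'a. (norm (x + y))\<^sup>2 + (norm (x - y))\<^sup>2 = 2 * (norm x)\<^sup>2 + 2 * (norm y)\<^sup>2"
    and "closed S" "convex S" "S \<noteq> {}"
  obtains p where "p \<in> S" "\<And>y. y \<in> S \<Longrightarrow> norm (a - p) \<le> norm (a - y)"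
proof -
  define d where "d = infdist a S"
  have d0: "d \<ge> 0" by (simp add: d_def infdist_nonneg)
  have d_le: "d \<le> norm (a - y)" if "y \<in> S" for y
    using infdist_le[OF that, of a] by (simp add: d_def dist_norm)
  have "\<exists>y\<in>S. norm (a - y) < d + 1 / real (Suc n)" for n
  proof -
    have "(INF y\<in>S. dist a y) < d + 1 / real (Suc n)"
      using assms(4) by (simp add: d_def infdist_def)
    then show ?thesis
      using assms(4) by (subst (asm) cINF_less_iff) (auto simp: dist_norm intro!: bdd_belowI2[of _ 0])
  qed
  then obtain y where yS: "\<And>n. y n \<in> S" and y: "\<And>n. norm (a - y n) < d + 1 / real (Suc n)"
    by metis
  \<comment> \<open>By convexity the midpoint of \<open>y m\<close> and \<open>y n\<close> is at
    distance at least \<open>d\<close> from \<open>a\<close>; the parallelogram law for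
    \<open>a - y m\<close> and \<open>a - y n\<close> then bounds their gap.\<close>
  have near: "(norm (y m - y n))\<^sup>2 \<le> 2 * ((norm (a - y m))\<^sup>2 - d\<^sup>2) + 2 * ((norm (a - y n))\<^sup>2 - d\<^sup>2)"
    for m n
  proof -
    have "(1/2) *\<^sub>R y m + (1/2) *\<^sub>R y n \<in> S"
      using \<open>convex S\<close> yS by (auto simp: convex_def)
    then have "d \<le> norm (a - ((1/2) *\<^sub>R y m + (1/2) *\<^sub>R y n))" by (rule d_le)
    then have "2 * d \<le> norm (2 *\<^sub>R (a - ((1/2) *\<^sub>R y m + (1/2) *\<^sub>R y n)))" by simp
    also have "2 *\<^sub>R (a - ((1/2) *\<^sub>R y m + (1/2) *\<^sub>R y n)) = (a - y m) + (a - y n)"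
      by (simp add: algebra_simps scaleR_2)
    finally have "(2 * d)\<^sup>2 \<le> (norm ((a - y m) + (a - y n)))\<^sup>2"
      using d0 by (intro power_mono) auto
    moreover have "norm ((a - y m) - (a - y n)) = norm (y m - y n)"
      by (simp add: norm_minus_commute)
    ultimately show ?thesis using par[of "a - y m" "a - y n"] by (simp add: power2_eq_square)
  qed
  have lim: "(\<lambda>n. norm (a - y n)) \<longlonglongrightarrow> d"
  proof (rule tendsto_sandwich[of "\<lambda>_. d" _ _ "\<lambda>n. d + 1 / real (Suc n)"])
    have "(\<lambda>n. d + 1 / real (Suc n)) \<longlonglongrightarrow> d + 0"
      by (intro tendsto_add tendsto_const lim_1_over_n[THEN LIMSEQ_Suc])
    then show "(\<lambda>n. d + 1 / real (Suc n)) \<longlonglongrightarrow> d" by simp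
  qed (use d_le yS y in \<open>auto intro!: always_eventually less_imp_le\<close>)
  define e where "e n = (norm (a - y n))\<^sup>2 - d\<^sup>2" for n
  have "e \<longlonglongrightarrow> d\<^sup>2 - d\<^sup>2" unfolding e_def by (intro tendsto_intros lim)
  then have e: "e \<longlonglongrightarrow> 0" by simp
  have "Cauchy y"
  proof (rule metric_CauchyI)
    fix r :: real assume "r > 0"
    then have "r\<^sup>2 / 4 > 0" by simp
    from order_tendstoD(2)[OF e this] obtain N where N: "\<And>n. n \<ge> N \<Longrightarrow> e n < r\<^sup>2 / 4"
      by (auto simp: eventually_sequentially)
    have "dist (y m) (y n) < r" if "m \<ge> N" "n \<ge> N" for m n
    proof -
      have "(norm (y m - y n))\<^sup>2 < r\<^sup>2"
        using near[of m n] N[OF that(1)] N[OF that(2)] by (simp add: e_def)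
      then show ?thesis using \<open>r > 0\<close> by (simp add: dist_norm power_less_imp_less_base)
    qed
    then show "\<exists>N. \<forall>m\<ge>N. \<forall>n\<ge>N. dist (y m) (y n) < r" by blast
  qed
  then obtain p where p: "y \<longlonglongrightarrow> p" by (auto simp: Cauchy_convergent_iff convergent_def)
  have "p \<in> S" using \<open>closed S\<close> yS p by (rule closed_sequentially)
  moreover have "(\<lambda>n. norm (a - y n)) \<longlonglongrightarrow> norm (a - p)" by (intro tendsto_intros p)
  then have "norm (a - p) = d" using lim LIMSEQ_unique by blast
  ultimately show thesis using that d_le by auto
qed

lemma cinner_add_left:
  "cinner (x + y) z = cinner x z + cinner (y :: 'h::complex_hilbert_space) z"
  by (metis cinner_commute cinner_add_right complex_cnj_add)

lemma cinner_scaleC_left: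
  "cinner (c *\<^sub>C x) y = cnj c * cinner x (y :: 'h::complex_hilbert_space)"
  by (metis cinner_commute cinner_scaleC_right complex_cnj_mult)

lemma cinner_zero_left: "cinner 0 (x :: 'h::complex_hilbert_space) = 0"
  using cinner_diff_left[of 0 0 x] by simp

lemma cinner_zero_right: "cinner (x :: 'h::complex_hilbert_space) 0 = 0"
  using cinner_diff_right[of x 0 0] by simp

lemma cinner_minus_left: "cinner (- x) y = - cinner x (y :: 'h::complex_hilbert_space)"
  using cinner_diff_left[of 0 x y] by (simp add: cinner_zero_left)

lemmas cinner_simps = cinner_add_left cinner_add_right cinner_diff_left cinner_diff_right
  cinner_scaleC_left cinner_scaleC_right

lemma norm_sq_eq_Re_cinner: "(norm x)\<^sup>2 = Re (cinner x (x :: 'h::complex_hilbert_space))"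
  by (simp add: cinner_self)

lemma parallelogram:
  fixes x y :: "'h::complex_hilbert_space"
  shows "(norm (x + y))\<^sup>2 + (norm (x - y))\<^sup>2 = 2 * (norm x)\<^sup>2 + 2 * (norm y)\<^sup>2"
  unfolding norm_sq_eq_Re_cinner by (simp add: cinner_simps)

lemma norm_diff_scaleR_sq:
  fixes x y :: "'h::complex_hilbert_space"
  shows "(norm (x - r *\<^sub>R y))\<^sup>2 = (norm x)\<^sup>2 - 2 * r * Re (cinner x y) + r\<^sup>2 * (norm y)\<^sup>2"
proof -
  have "Re (cinner y x) = Re (cinner x y)" using cinner_commute[of y x] by simp
  then show ?thesis
    unfolding norm_sq_eq_Re_cinner scaleR_scaleC
    by (simp add: cinner_simps power2_eq_square algebra_simps)
qed

lemma linear_coeff_eq_0_if_quadratic_nonneg: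
  fixes b c :: real
  assumes "\<And>r. 0 \<le> r\<^sup>2 * c - 2 * r * b"
  shows "b = 0"
proof (rule ccontr)
  assume "b \<noteq> 0"
  \<comment> \<open>At \<open>r = b / k\<close> the linear term outweighs the quadratic one,
    whatever the sign of \<open>c\<close>; the added 1 keeps \<open>k\<close> positive when
    \<open>c = 0\<close>.\<close>
  define k where "k = \<bar>c\<bar> + 1"
  have "k > 0" "c < 2 * k" by (auto simp: k_def)
  have "0 \<le> (b / k)\<^sup>2 * c - 2 * (b / k) * b" by (rule assms)
  also have "\<dots> = (b / k)\<^sup>2 * (c - 2 * k)"
    using \<open>k > 0\<close> by (simp add: field_simps power2_eq_square)
  also have "\<dots> < 0"
    using \<open>b \<noteq> 0\<close> \<open>k > 0\<close> \<open>c < 2 * k\<close> by (intro mult_pos_neg) auto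
  finally show False by simp
qed

text \<open>The point of \<open>G\<close> closest to \<open>(a, b)\<close> has an orthogonal
  residual, by first variation. The inner product of the product space is written out as a sum of
  two terms.\<close>

lemma orthogonal_component_prod:
  fixes G :: "('h::complex_hilbert_space \<times> 'h) set"
  assumes "closed G" "G \<noteq> {}"
    and add: "\<And>f g h k. (f, h) \<in> G \<Longrightarrow> (g, k) \<in> G \<Longrightarrow> (f + g, h + k) \<in> G"
    and scale: "\<And>c f h. (f, h) \<in> G \<Longrightarrow> (c *\<^sub>C f, c *\<^sub>C h) \<in> G"
  obtains p q where "(p, q) \<in> G"
    "\<And>f h. (f, h) \<in> G \<Longrightarrow> cinner (a - p) f + cinner (b - q) h = 0"
proof -
  have scaleR: "r *\<^sub>R g \<in> G" if "g \<in> G" for r and g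
    using scale[of "fst g" "snd g"] that by (simp add: scaleR_scaleC scaleR_prod_def)
  have plus: "g + h \<in> G" if "g \<in> G" "h \<in> G" for g h
    using add[of "fst g" "snd g" "fst h" "snd h"] that by (simp add: plus_prod_def)
  have "convex G" by (auto simp: convex_def intro!: plus scaleR)
  have norm_sq: "(norm x)\<^sup>2 = (norm (fst x))\<^sup>2 + (norm (snd x))\<^sup>2" for x :: "'h \<times> 'h"
    by (simp add: norm_prod_def)
  have par: "(norm (x + y))\<^sup>2 + (norm (x - y))\<^sup>2 = 2 * (norm x)\<^sup>2 + 2 * (norm y)\<^sup>2"
    for x y :: "'h \<times> 'h"
    using parallelogram[of "fst x" "fst y"] parallelogram[of "snd x" "snd y"]
    by (simp add: norm_sq)
  obtain s where s: "s \<in> G" "\<And>y. y \<in> G \<Longrightarrow> norm ((a, b) - s) \<le> norm ((a, b) - y)"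
    using closest_point_parallelogram[OF par \<open>closed G\<close> \<open>convex G\<close> \<open>G \<noteq> {}\<close>] by blast
  obtain p q where pq: "s = (p, q)" by (cases s)
  \<comment> \<open>Moving from \<open>s\<close> by \<open>r *\<^sub>R (f, h)\<close> stays in
    \<open>G\<close> and cannot reduce the distance, so a quadratic in \<open>r\<close> without
    constant term is nonnegative and its linear coefficient vanishes.\<close>
  have Re0: "Re (cinner (a - p) f + cinner (b - q) h) = 0" if fh: "(f, h) \<in> G" for f h
  proof (rule linear_coeff_eq_0_if_quadratic_nonneg)
    fix r :: real
    have "s + r *\<^sub>R (f, h) \<in> G" by (intro plus s(1) scaleR fh)
    then have "(norm ((a, b) - s))\<^sup>2 \<le> (norm ((a, b) - (s + r *\<^sub>R (f, h))))\<^sup>2"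
      by (intro power_mono s(2)) auto
    also have "(a, b) - (s + r *\<^sub>R (f, h)) = ((a - p) - r *\<^sub>R f, (b - q) - r *\<^sub>R h)"
      by (simp add: pq)
    finally show "0 \<le> r\<^sup>2 * ((norm f)\<^sup>2 + (norm h)\<^sup>2) -
        2 * r * Re (cinner (a - p) f + cinner (b - q) h)"
      by (simp add: pq norm_sq norm_diff_scaleR_sq ring_distribs)
  qed
  \<comment> \<open>Applying \<open>Re0\<close> to \<open>\<i>\<close> times the pair kills the
    imaginary part.\<close>
  have "cinner (a - p) f + cinner (b - q) h = 0" if fh: "(f, h) \<in> G" for f h
    using Re0[OF fh] Re0[OF scale[OF fh, of \<i>]]
    by (auto simp: cinner_scaleC_right complex_eq_iff)
  then show thesis using that s(1) pq by blast
qed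

section \<open>Adjoints\<close>

lemma app_eqI: "A f = Some h \<Longrightarrow> A \<cdot> f = h"
  by (simp add: app_def)

lemma Some_app: "f \<in> dom A \<Longrightarrow> A f = Some (A \<cdot> f)"
  by (auto simp: app_def)

lemma adjoint_add:
  assumes "densely_defined A" "(A\<^sup>\<dagger>) g = Some h" "(A\<^sup>\<dagger>) g' = Some h'"
  shows "(A\<^sup>\<dagger>) (g + g') = Some (h + h')"
  using assms by (simp add: adjoint_eq_Some_iff cinner_add_left)

lemma adjoint_scaleC:
  assumes "densely_defined A" "(A\<^sup>\<dagger>) g = Some h"
  shows "(A\<^sup>\<dagger>) (c *\<^sub>C g) = Some (c *\<^sub>C h)"
  using assms by (simp add: adjoint_eq_Some_iff cinner_scaleC_left)

text \<open>Since \<open>C\<close> is an involution that reverses inner products, it moves from one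
  argument to the other; commutation with \<open>A\<close> thereby passes to the adjoint.\<close>

lemma adjoint_conjugation:
  assumes A: "densely_defined A" and C: "complex_conjugation C" "commutes_with C A"
    and g: "(A\<^sup>\<dagger>) g = Some h"
  shows "(A\<^sup>\<dagger>) (C g) = Some (C h)"
  unfolding adjoint_eq_Some_iff[OF A]
proof
  fix f assume f: "f \<in> dom A"
  have C': "C (C x) = x" "cinner (C x) (C y) = cinner y x" for x y
    using C(1) by (auto simp: complex_conjugation_def)
  have Cf: "C f \<in> dom A" "C (A \<cdot> f) = A \<cdot> C f"
    using C(2) f by (auto simp: commutes_with_def)
  have "cinner (C g) (A \<cdot> f) = cinner (A \<cdot> C f) g"
    using C'(2)[of g "C (A \<cdot> f)"] unfolding C'(1) unfolding Cf(2) .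
  also have "\<dots> = cinner (C f) h"
    using g Cf(1) unfolding adjoint_eq_Some_iff[OF A] by (metis cinner_commute)
  also have "\<dots> = cinner (C h) f"
    using C'(2)[of h "C f"] unfolding C'(1) by (rule sym)
  finally show "cinner (C g) (A \<cdot> f) = cinner (C h) f" .
qed

text \<open>The contrapositive form of \<open>ker A\<^sup>\<dagger>\<^sup>\<dagger> \<subseteq> ker A\<close>, the only part of
  \<open>A\<^sup>\<dagger>\<^sup>\<dagger> = A\<close> that is needed.\<close>

lemma adjoint_range_not_orthogonal:
  assumes lin: "linear_operator A" and dd: "densely_defined A" and cl: "closed_operator A"
    and "\<phi> \<notin> ker A"
  obtains v w where "(A\<^sup>\<dagger>) v = Some w" "cinner \<phi> w \<noteq> 0"
proof -
  have sub: "complex_vector.subspace (dom A)" using lin by (simp add: linear_operator_def)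
  have gr: "(f, h) \<in> Map.graph A \<longleftrightarrow> f \<in> dom A \<and> A \<cdot> f = h" for f h
    by (auto simp: Map.graph_def app_def)
  have "(0, A \<cdot> 0) \<in> Map.graph A" using complex_vector.subspace_0[OF sub] gr by blast
  then have "Map.graph A \<noteq> {}" by blast
  have add: "(f + g, h + k) \<in> Map.graph A"
    if "(f, h) \<in> Map.graph A" "(g, k) \<in> Map.graph A" for f g h k
    using that lin complex_vector.subspace_add[OF sub, of f g]
    by (auto simp only: gr linear_operator_def)
  have scale: "(c *\<^sub>C f, c *\<^sub>C h) \<in> Map.graph A" if "(f, h) \<in> Map.graph A" for c f h
    using that lin complex_vector.subspace_scale[OF sub, of f c]
    by (auto simp only: gr linear_operator_def)
  obtain p q where pq: "(p, q) \<in> Map.graph A" and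
    orth: "\<And>f h. (f, h) \<in> Map.graph A \<Longrightarrow> cinner (\<phi> - p) f + cinner (0 - q) h = 0"
    using orthogonal_component_prod[OF cl[unfolded closed_operator_def] \<open>Map.graph A \<noteq> {}\<close> add scale]
    by blast
  \<comment> \<open>Orthogonality of \<open>(\<phi> - p, - q)\<close> to the graph is exactly the
    defining identity of the adjoint at \<open>q\<close>.\<close>
  have "(A\<^sup>\<dagger>) q = Some (\<phi> - p)"
    unfolding adjoint_eq_Some_iff[OF dd]
  proof
    fix f assume "f \<in> dom A"
    then have "cinner (\<phi> - p) f + cinner (0 - q) (A \<cdot> f) = 0" using orth gr by blast
    then show "cinner q (A \<cdot> f) = cinner (\<phi> - p) f"
      by (simp add: cinner_minus_left)
  qed
  \<comment> \<open>Otherwise testing the residual against \<open>(p, q)\<close> itself forces it to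
    vanish, which puts \<open>(\<phi>, 0)\<close> in the graph.\<close>
  moreover have "cinner \<phi> (\<phi> - p) \<noteq> 0"
  proof
    assume "cinner \<phi> (\<phi> - p) = 0"
    then have "cinner (\<phi> - p) \<phi> = 0" using cinner_commute[of "\<phi> - p" \<phi>] by simp
    with orth[OF pq] have "cinner (\<phi> - p) (\<phi> - p) + cinner q q = 0"
      by (simp add: cinner_diff_right cinner_minus_left)
    then have "complex_of_real ((norm (\<phi> - p))\<^sup>2 + (norm q)\<^sup>2) = 0"
      by (simp add: cinner_self)
    then have "(norm (\<phi> - p))\<^sup>2 + (norm q)\<^sup>2 = 0" by (simp only: of_real_eq_0_iff)
    then have "\<phi> = p" "q = 0" by (simp_all add: add_nonneg_eq_0_iff)
    then show False using pq \<open>\<phi> \<notin> ker A\<close> by (auto simp: gr ker_def)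
  qed
  ultimately show thesis using that by blast
qed

text \<open>Exchanging generators that are congruent modulo \<open>dom A\<close> changes each vector
  by a multiple of their difference, which the subspace absorbs.\<close>

lemma ext_dom_eqI:
  assumes sub: "complex_vector.subspace (dom A)"
    and d: "(complex_of_real t *\<^sub>C \<phi> + \<psi>) - (complex_of_real t' *\<^sub>C \<phi> + \<psi>') \<in> dom A"
  shows "ext_dom A \<phi> t \<psi> = ext_dom A \<phi> t' \<psi>'"
proof -
  have incl: "{f + \<alpha> *\<^sub>C u | f \<alpha>. f \<in> dom A} \<subseteq> {f + \<alpha> *\<^sub>C v | f \<alpha>. f \<in> dom A}"
    if "u - v \<in> dom A" for u v
  proof
    fix z assume "z \<in> {f + \<alpha> *\<^sub>C u | f \<alpha>. f \<in> dom A}"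
    then obtain f \<alpha> where f: "f \<in> dom A" "z = f + \<alpha> *\<^sub>C u" by blast
    then have "f + \<alpha> *\<^sub>C (u - v) \<in> dom A"
      by (intro complex_vector.subspace_add[OF sub] complex_vector.subspace_scale[OF sub] that)
    moreover have "f + \<alpha> *\<^sub>C u = (f + \<alpha> *\<^sub>C (u - v)) + \<alpha> *\<^sub>C v"
      by (simp add: complex_vector.scale_right_diff_distrib)
    ultimately show "z \<in> {f + \<alpha> *\<^sub>C v | f \<alpha>. f \<in> dom A}"
      using f(2) by blast
  qed
  have "(complex_of_real t' *\<^sub>C \<phi> + \<psi>') - (complex_of_real t *\<^sub>C \<phi> + \<psi>) \<in> dom A"
    using complex_vector.subspace_neg[OF sub d] by (simp only: minus_diff_eq)
  with incl d show ?thesis unfolding ext_dom_def by (intro equalityI) auto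
qed

lemma quadratic_difference_surj:
  fixes a b s :: real
  assumes "b \<noteq> 0"
  obtains x y where "(b * x + a * x\<^sup>2) - (b * y + a * y\<^sup>2) = s"
proof (cases "a = 0")
  case True
  with assms that[of "s / b" 0] show ?thesis by simp
next
  case False
  \<comment> \<open>The witnesses below satisfy \<open>x - y = 1\<close> and
    \<open>x + y = m\<close>, so the difference of values is \<open>b + a * m\<close>.\<close>
  define m where "m = (s - b) / a"
  have "a * m = s - b" using False by (simp add: m_def)
  then show ?thesis
    by (intro that[of "(m + 1) / 2" "(m - 1) / 2"]) (simp add: field_simps power2_eq_square)
qed

section \<open>Existence of the two real vectors\<close>

context
  fixes C :: "'h::complex_hilbert_space \<Rightarrow> 'h"
  assumes C: "complex_conjugation C"
begin

lemma conjugation_add: "C (f + g) = C f + C g"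
  and conjugation_scaleC: "C (c *\<^sub>C f) = cnj c *\<^sub>C C f"
  and conjugation_conjugation: "C (C f) = f"
  and cinner_conjugation: "cinner (C f) (C g) = cinner g f"
  using C by (auto simp: complex_conjugation_def)

text \<open>On vectors fixed by \<open>C\<close>, reversal of inner products becomes symmetry, which
  with conjugate symmetry makes them real.\<close>

lemma cinner_real_of_conjugation_fixed:
  assumes "C f = f" "C g = g"
  shows "cinner f g = complex_of_real (Re (cinner f g))" "cinner g f = cinner f g"
proof -
  show "cinner g f = cinner f g" using cinner_conjugation[of f g] assms by simp
  then show "cinner f g = complex_of_real (Re (cinner f g))"
    using cinner_commute[of f g] by (simp add: complex_eq_iff)
qed

end

theorem proposition5p4p1:
  fixes A :: "'h::complex_hilbert_space operator"
    and C :: "'h \<Rightarrow> 'h"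
    and \<phi> :: 'h
  assumes "symmetric_operator A" and "closed_operator A"
    and "ker A = {0}"
    and "complex_conjugation C" and "commutes_with C A"
    and "deficiency_plus A = 1"
    and "complex_vector.dim (ker (A\<^sup>\<dagger>)) = 1"
    and "\<phi> \<in> ker (A\<^sup>\<dagger>) - {0}" and "C \<phi> = \<phi>"
  shows "\<forall>t\<^sub>1 t\<^sub>2 :: real. t\<^sub>1 \<noteq> t\<^sub>2 \<longrightarrow>
    (\<exists>\<psi>\<^sub>1 \<in> S_set A C \<phi>. \<exists>\<psi>\<^sub>2 \<in> S_set A C \<phi>.
       ext_dom A \<phi> t\<^sub>1 \<psi>\<^sub>1 = ext_dom A \<phi> t\<^sub>2 \<psi>\<^sub>2)"
proof (intro allI impI)
  fix t\<^sub>1 t\<^sub>2 :: real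
  note C = assms(4) and CA = assms(5)
  note C_simps = conjugation_add[OF C] conjugation_scaleC[OF C] conjugation_conjugation[OF C]
  have lin: "linear_operator A" and dd: "densely_defined A" and ext: "A \<subseteq>\<^sub>m A\<^sup>\<dagger>"
    using assms(1) by (auto simp: symmetric_operator_def)
  have sub: "complex_vector.subspace (dom A)" using lin by (simp add: linear_operator_def)
  have A_adj: "(A\<^sup>\<dagger>) f = Some (A \<cdot> f)" if "f \<in> dom A" for f
    using ext that Some_app[OF that] by (auto simp: map_le_def)
  have \<phi>: "(A\<^sup>\<dagger>) \<phi> = Some 0" using assms(8) Some_app[of \<phi> "A\<^sup>\<dagger>"] by (auto simp: ker_def)
  then have \<phi>_orth: "cinner \<phi> (A \<cdot> f) = 0" if "f \<in> dom A" for f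
    using that by (simp add: adjoint_eq_Some_iff[OF dd] cinner_zero_left)

  \<comment> \<open>A real vector in the domain of the adjoint, normalised against \<phi>\<close>
  have "\<phi> \<notin> ker A" using assms(3,8) by auto
  then obtain v w where vw: "(A\<^sup>\<dagger>) v = Some w" "cinner \<phi> w \<noteq> 0"
    using adjoint_range_not_orthogonal[OF lin dd assms(2)] by blast
  \<comment> \<open>This factor gives \<open>c *\<^sub>C w\<close> the pairing 1/2 with \<phi>. As
    \<phi> is real, its conjugate contributes the complex conjugate, again 1/2, and the total is
    1.\<close>
  define c where "c = 1 / (2 * cinner \<phi> w)"
  define \<psi> where "\<psi> = c *\<^sub>C v + C (c *\<^sub>C v)"
  define \<eta> where "\<eta> = c *\<^sub>C w + C (c *\<^sub>C w)"
  have \<psi>\<eta>: "(A\<^sup>\<dagger>) \<psi> = Some \<eta>"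
    unfolding \<psi>_def \<eta>_def
    by (intro adjoint_add[OF dd] adjoint_conjugation[OF dd C CA] adjoint_scaleC[OF dd] vw(1))
  have C\<psi>: "C \<psi> = \<psi>" and C\<eta>: "C \<eta> = \<eta>"
    by (simp_all add: \<psi>_def \<eta>_def C_simps add.commute)
  have "cinner \<phi> (c *\<^sub>C w) = 1 / 2" using vw(2) by (simp add: c_def cinner_scaleC_right)
  moreover have "cinner \<phi> (C (c *\<^sub>C w)) = cnj (cinner \<phi> (c *\<^sub>C w))"
    using cinner_conjugation[OF C, of \<phi> "c *\<^sub>C w"] cinner_commute[of "c *\<^sub>C w" \<phi>] assms(9) by simp
  ultimately have \<phi>\<eta>: "cinner \<phi> \<eta> = 1"
    by (simp only: \<eta>_def cinner_add_right) simp

  \<comment> \<open>A real direction in the domain of \<open>A\<close> not orthogonal to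
    \<eta>\<close>
  have "\<eta> \<noteq> 0" using \<phi>\<eta> by (auto simp: cinner_zero_right)
  then obtain g where g: "g \<in> dom A" "cinner \<eta> g \<noteq> 0"
    using orthogonal_dense_eq_0[of "dom A" \<eta>] dd by (auto simp: densely_defined_def)
  \<comment> \<open>The phase is rotated so that the pairing with \<eta> is positive; symmetrising
    under \<open>C\<close> then doubles it, whereas an imaginary pairing would cancel.\<close>
  define g' where "g' = cnj (cinner \<eta> g) *\<^sub>C g"
  define f where "f = g' + C g'"
  have g': "g' \<in> dom A" unfolding g'_def by (rule complex_vector.subspace_scale[OF sub g(1)])
  have "C g' \<in> dom A" using g' CA by (auto simp: commutes_with_def)
  then have f: "f \<in> dom A" unfolding f_def by (intro complex_vector.subspace_add[OF sub] g')
  have Cf: "C f = f" by (simp add: f_def C_simps add.commute)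
  then have CAf: "C (A \<cdot> f) = A \<cdot> f" using f CA by (auto simp: commutes_with_def)
  have "cinner \<eta> g' = complex_of_real ((cmod (cinner \<eta> g))\<^sup>2)"
    unfolding g'_def cinner_scaleC_right complex_norm_square by (rule mult.commute)
  moreover have "cinner \<eta> (C g') = cnj (cinner \<eta> g')"
    using cinner_conjugation[OF C, of \<eta> g'] cinner_commute[of g' \<eta>] C\<eta> by simp
  ultimately have "cinner \<eta> f = complex_of_real (2 * (cmod (cinner \<eta> g))\<^sup>2)"
    by (simp only: f_def cinner_add_right) simp
  then have \<eta>f: "Re (cinner \<eta> f) \<noteq> 0" using g(2) by simp

  \<comment> \<open>The quadratic family and the choice of its parameters\<close>
  define a where "a = Re (cinner f (A \<cdot> f))"
  define b where "b = Re (cinner \<eta> f)"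
  define k where "k = Re (cinner \<psi> \<eta>)"
  have "cinner f (A \<cdot> f) = a" "cinner \<eta> f = b" "cinner f \<eta> = b" "cinner \<psi> \<eta> = k"
    unfolding a_def b_def k_def using cinner_real_of_conjugation_fixed[OF C] Cf CAf C\<eta> C\<psi> by metis+
  \<comment> \<open>By this identity both cross terms of the quadratic form equal \<open>b\<close>,
    whence the coefficient \<open>2 * b\<close> in \<open>q\<close>.\<close>
  moreover have "cinner \<psi> (A \<cdot> f) = cinner \<eta> f"
    using \<psi>\<eta> f by (simp add: adjoint_eq_Some_iff[OF dd])
  ultimately have vals: "cinner f (A \<cdot> f) = a" "cinner f \<eta> = b" "cinner \<psi> \<eta> = k"
    "cinner \<psi> (A \<cdot> f) = b" by auto
  define q where "q x = k + (2 * b * x + a * x\<^sup>2)" for x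
  \<comment> \<open>The \<phi> term leaves the image under \<open>A\<^sup>\<dagger>\<close>
    unchanged and, since \<phi> pairs to 1 with that image, subtracts exactly \<open>q x\<close>
    from the quadratic form.\<close>
  define \<Psi> where "\<Psi> x = \<psi> + complex_of_real x *\<^sub>C f + complex_of_real (- q x) *\<^sub>C \<phi>" for x
  have \<Psi>_S: "\<Psi> x \<in> S_set A C \<phi>" for x
  proof -
    define \<theta> where "\<theta> = \<eta> + complex_of_real x *\<^sub>C (A \<cdot> f)"
    have "(A\<^sup>\<dagger>) (\<Psi> x) = Some (\<eta> + complex_of_real x *\<^sub>C (A \<cdot> f) + complex_of_real (- q x) *\<^sub>C 0)"
      unfolding \<Psi>_def by (intro adjoint_add[OF dd] adjoint_scaleC[OF dd] \<psi>\<eta> A_adj f \<phi>)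
    then have \<theta>: "(A\<^sup>\<dagger>) (\<Psi> x) = Some \<theta>" by (simp add: \<theta>_def)
    have one: "cinner \<phi> \<theta> = 1" by (simp add: \<theta>_def cinner_simps \<phi>\<eta> \<phi>_orth[OF f])
    \<comment> \<open>On \<open>dom A\<close> the adjoint agrees with \<open>A\<close>, whose range
      is orthogonal to \<phi>, contrary to the pairing 1.\<close>
    have "\<Psi> x \<notin> dom A"
    proof
      assume "\<Psi> x \<in> dom A"
      then have "cinner \<phi> \<theta> = 0" using A_adj[of "\<Psi> x"] \<phi>_orth[of "\<Psi> x"] \<theta> by simp
      with one show False by simp
    qed
    moreover have "C (\<Psi> x) = \<Psi> x"
      unfolding \<Psi>_def C_simps C\<psi> Cf assms(9) complex_cnj_complex_of_real ..
    moreover have "cinner (\<Psi> x) \<theta> = 0"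
    proof -
      have "cinner (\<Psi> x) \<theta> = cinner \<psi> \<theta> + complex_of_real x * cinner f \<theta> - complex_of_real (q x)"
        by (simp add: \<Psi>_def cinner_simps one)
      also have "\<dots> = 0"
        by (simp add: \<theta>_def cinner_simps vals q_def power2_eq_square algebra_simps)
      finally show ?thesis .
    qed
    ultimately show ?thesis
      using one \<theta> by (auto simp: S_set_def app_eqI[of "A\<^sup>\<dagger>", OF \<theta>])
  qed
  have "2 * b \<noteq> 0" using \<eta>f by (simp add: b_def)
  then obtain x y where xy: "(2 * b * x + a * x\<^sup>2) - (2 * b * y + a * y\<^sup>2) = t\<^sub>1 - t\<^sub>2"
    by (rule quadratic_difference_surj)
  \<comment> \<open>With this relation the \<phi> components of the two generators cancel, leaving a
    multiple of \<open>f\<close>.\<close>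
  have "q x = q y + t\<^sub>1 - t\<^sub>2" using xy by (simp add: q_def)
  then have "(complex_of_real t\<^sub>1 *\<^sub>C \<phi> + \<Psi> x) - (complex_of_real t\<^sub>2 *\<^sub>C \<phi> + \<Psi> y)
      = complex_of_real (x - y) *\<^sub>C f"
    by (simp add: \<Psi>_def complex_vector.scale_left_distrib complex_vector.scale_left_diff_distrib)
  then have "ext_dom A \<phi> t\<^sub>1 (\<Psi> x) = ext_dom A \<phi> t\<^sub>2 (\<Psi> y)"
    using complex_vector.subspace_scale[OF sub f] by (intro ext_dom_eqI[OF sub]) metis
  then show "\<exists>\<psi>\<^sub>1 \<in> S_set A C \<phi>. \<exists>\<psi>\<^sub>2 \<in> S_set A C \<phi>. ext_dom A \<phi> t\<^sub>1 \<psi>\<^sub>1 = ext_dom A \<phi> t\<^sub>2 \<psi>\<^sub>2"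
    using \<Psi>_S by blast
qed

end
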